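(* Let $F=f+h$ be as in the context, suppose $f$ is H\"older smooth with exponent $\nu\in[0,1]$ and constant $L_\nu>0$, and let $\rho>0$, $\bar x\in\operatorname{dom}F$. Consider the sequence generated by ProxBundle with center $\bar x$ and parameter $\rho$ (run without termination), with model errors $e_j$ and proximal-value gaps $\delta_j$. Let $G_\nu=\left(\frac{L_\nu}{1+\nu}\right)^{-\frac{2}{1+\nu}}$. (i) If $\nu=1$, then $$e_{j+1}\le\frac{L_1}{\rho}\left(1+\frac{\rho}{L_1}\right)^{-j}\delta_0,\qquad j\ge0.$$ (ii) If $\nu\in[0,1)$, then for every integer $t\ge1$, $$\min_{t+1\le j\le2t}e_j\le\left(\frac{2\delta_t}{\rho G_\nu t}\right)^{\frac{1+\nu}{2}}\le\max\left\{\delta_0e^{-t/2},\left(\frac{4(1+\nu)}{(1-\nu)\rho G_\nu t}\right)^{\frac{1+\nu}{1-\nu}}\right\}.$$ In particular, $$\min_{t+1\le j\le2t}e_j=\mathcal{O}\left(L_\nu^{\frac{2}{1-\nu}}\rho^{-\frac{1+\nu}{1-\nu}}t^{-\frac{1+\nu}{1-\nu}}\right)$$ as $t\to\infty$, with hidden constant depending only on $\nu$ (for all sufficiently large $t$).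
   Context: Problem. $F=f+h$ on $\mathbb{R}^n$, where $f:\mathbb{R}^n\to\mathbb{R}$ is finite-valued and convex and $h:\mathbb{R}^n\to\mathbb{R}\cup\{+\infty\}$ is proper, lower semicontinuous and convex; $F$ attains its minimum. $\partial$ is the convex subdifferential, $\|\cdot\|$ the Euclidean norm. H\"older smoothness with exponent $\nu\in[0,1]$ and constant $L_\nu$: $\|g_x-g_y\|\le L_\nu\|x-y\|^\nu$ for all $x,y\in\mathbb{R}^n$ and all $g_x\in\partial f(x)$, $g_y\in\partial f(y)$ (for $\nu=0$ the right-hand side is $L_0$). ProxBundle with center $\bar x\in\operatorname{dom}F$ and parameter $\rho>0$. Set $z_0=\bar x$. For $j=0,1,2,\dots$: choose any convex model $f_j:\mathbb{R}^n\to\mathbb{R}$ such that (1) $f_j(x)\le f(x)$ for all $x$; (2) for some $g_j\in\partial f(z_j)$, $f_j(x)\ge f(z_j)+\langle g_j,x-z_j\rangle$ for all $x$; (3) if $j\ge1$, there exist $a_j\in\partial f_{j-1}(z_j)$ and $b_j\in\partial h(z_j)$ with $a_j+b_j=\rho(\bar x-z_j)$ such that $f_j(x)\ge f_{j-1}(z_j)+\langle a_j,x-z_j\rangle$ for all $x$. Let $F_j=f_j+h$ and $z_{j+1}=\arg\min_x\{F_j(x)+\frac{\rho}{2}\|x-\bar x\|^2\}$. Quantities: $F_{1/\rho}(\bar x)=\min_x\{F(x)+\frac{\rho}{2}\|x-\bar x\|^2\}$, $m_j=\min_x\{F_j(x)+\frac{\rho}{2}\|x-\bar x\|^2\}$,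 proximal-value gap $\delta_j=F_{1/\rho}(\bar x)-m_j$ (nonnegative), model error $e_j=f(z_{j+1})-f_j(z_{j+1})$. *)

theory Defs
  imports "HOL-Analysis.Analysis"
begin

definition effective_domain :: "('a \<Rightarrow> ereal) \<Rightarrow> 'a set" where
  "effective_domain \<phi> = {x. \<phi> x < \<infinity>}"

definition proper_fun :: "('a \<Rightarrow> ereal) \<Rightarrow> bool" where
  "proper_fun \<phi> \<longleftrightarrow> (\<forall>x. \<phi> x \<noteq> -\<infinity>) \<and> effective_domain \<phi> \<noteq> {}"

definition lower_semicontinuous :: "('a::topological_space \<Rightarrow> ereal) \<Rightarrow> bool" where
  "lower_semicontinuous \<phi> \<longleftrightarrow> (\<forall>x. \<phi> x \<le> Liminf (at x) \<phi>)"

text \<open>Only used for functions that never take the value \<open>-\<infinity>\<close>, so the sum on the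
  right-hand side is never of the form \<open>\<infinity> - \<infinity>\<close>; also \<open>0 * \<infinity> = 0\<close> in \<open>ereal\<close>.\<close>

definition convex_ereal :: "('a::real_vector \<Rightarrow> ereal) \<Rightarrow> bool" where
  "convex_ereal \<phi> \<longleftrightarrow>
     (\<forall>x y u v. 0 \<le> u \<longrightarrow> 0 \<le> v \<longrightarrow> u + v = 1 \<longrightarrow>
        \<phi> (u *\<^sub>R x + v *\<^sub>R y) \<le> ereal u * \<phi> x + ereal v * \<phi> y)"

text \<open>The subdifferential is empty at points where \<open>\<phi>\<close> is not finite. For a real-valued
  \<open>f\<close> it is written \<open>subdifferential (\<lambda>x. ereal (f x))\<close>.\<close>

definition subdifferential :: "('a::real_inner \<Rightarrow> ereal) \<Rightarrow> 'a \<Rightarrow> 'a set" where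
  "subdifferential \<phi> x =
     {g. \<bar>\<phi> x\<bar> \<noteq> \<infinity> \<and> (\<forall>y. \<phi> x + ereal (g \<bullet> (y - x)) \<le> \<phi> y)}"

text \<open>For \<open>\<nu> = 0\<close> the bound is \<open>L\<close> even if \<open>x = y\<close>, whereas \<open>0 powr 0 = 0\<close>; hence the
  case distinction.\<close>

definition holder_smooth :: "real \<Rightarrow> real \<Rightarrow> ('a::real_inner \<Rightarrow> real) \<Rightarrow> bool" where
  "holder_smooth \<nu> L f \<longleftrightarrow>
     (\<forall>x y. \<forall>gx \<in> subdifferential (\<lambda>x. ereal (f x)) x.
            \<forall>gy \<in> subdifferential (\<lambda>x. ereal (f x)) y.
        norm (gx - gy) \<le> L * (if \<nu> = 0 then 1 else norm (x - y) powr \<nu>))"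

definition composite :: "('a \<Rightarrow> real) \<Rightarrow> ('a \<Rightarrow> ereal) \<Rightarrow> 'a \<Rightarrow> ereal" where
  "composite f h x = ereal (f x) + h x"

definition prox_objective ::
  "('a::real_inner \<Rightarrow> ereal) \<Rightarrow> real \<Rightarrow> 'a \<Rightarrow> 'a \<Rightarrow> ereal" where
  "prox_objective \<phi> \<rho> xbar x = \<phi> x + ereal (\<rho> / 2 * (norm (x - xbar))\<^sup>2)"

definition prox_value :: "('a::real_inner \<Rightarrow> ereal) \<Rightarrow> real \<Rightarrow> 'a \<Rightarrow> ereal" where
  "prox_value \<phi> \<rho> xbar = (INF x. prox_objective \<phi> \<rho> xbar x)"

lemma prox_value_eq_minimum:
  assumes "is_arg_min (prox_objective \<phi> \<rho> xbar) (\<lambda>_. True) x"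
  shows "prox_value \<phi> \<rho> xbar = prox_objective \<phi> \<rho> xbar x"
  unfolding prox_value_def using assms
  by (intro antisym INF_lower INF_greatest) (auto simp: is_arg_min_linorder)

lemma prox_value_finite:
  assumes "proper_fun \<phi>" and "\<exists>x. is_arg_min \<phi> (\<lambda>_. True) x" and "\<rho> > 0"
  shows "\<bar>prox_value \<phi> \<rho> xbar\<bar> \<noteq> \<infinity>"
proof -
  obtain x where x: "\<And>y. \<phi> x \<le> \<phi> y"
    using assms(2) by (auto simp: is_arg_min_linorder)
  obtain w where w: "\<phi> w < \<infinity>"
    using assms(1) by (auto simp: proper_fun_def effective_domain_def)
  have "\<phi> x \<le> prox_objective \<phi> \<rho> xbar y" for y
    using add_mono[OF x[of y], of 0 "ereal (\<rho> / 2 * (norm (y - xbar))\<^sup>2)"] \<open>\<rho> > 0\<close>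
    by (simp add: prox_objective_def)
  then have "\<phi> x \<le> prox_value \<phi> \<rho> xbar"
    by (simp add: prox_value_def INF_greatest)
  moreover have "prox_value \<phi> \<rho> xbar \<le> prox_objective \<phi> \<rho> xbar w"
    by (simp add: prox_value_def INF_lower)
  moreover have "prox_objective \<phi> \<rho> xbar w < \<infinity>"
    using w by (simp add: prox_objective_def)
  moreover have "\<phi> x \<noteq> -\<infinity>"
    using assms(1) by (auto simp: proper_fun_def)
  ultimately show ?thesis by auto
qed

text \<open>\<open>prox_bundle f h \<rho> xbar fm z\<close>: the models \<open>fm j\<close> and the points \<open>z j\<close> form a
  possible non-terminating run with center \<open>xbar\<close> and parameter \<open>\<rho>\<close>.\<close>

definition prox_bundle ::
  "('a::real_inner \<Rightarrow> real) \<Rightarrow> ('a \<Rightarrow> ereal) \<Rightarrow> real \<Rightarrow> 'a \<Rightarrow>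
   (nat \<Rightarrow> 'a \<Rightarrow> real) \<Rightarrow> (nat \<Rightarrow> 'a) \<Rightarrow> bool" where
  "prox_bundle f h \<rho> xbar fm z \<longleftrightarrow>
     z 0 = xbar \<and>
     (\<forall>j. convex_on UNIV (fm j) \<and>
          (\<forall>x. fm j x \<le> f x) \<and>
          (\<exists>g \<in> subdifferential (\<lambda>x. ereal (f x)) (z j).
             \<forall>x. f (z j) + g \<bullet> (x - z j) \<le> fm j x) \<and>
          (j \<ge> 1 \<longrightarrow>
             (\<exists>a \<in> subdifferential (\<lambda>x. ereal (fm (j - 1) x)) (z j).
              \<exists>b \<in> subdifferential h (z j).
                a + b = \<rho> *\<^sub>R (xbar - z j) \<and>
                (\<forall>x. fm (j - 1) (z j) + a \<bullet> (x - z j) \<le> fm j x))) \<and>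
          is_arg_min (prox_objective (composite (fm j) h) \<rho> xbar) (\<lambda>_. True) (z (Suc j)))"

definition model_error ::
  "('a \<Rightarrow> real) \<Rightarrow> (nat \<Rightarrow> 'a \<Rightarrow> real) \<Rightarrow> (nat \<Rightarrow> 'a) \<Rightarrow> nat \<Rightarrow> real" where
  "model_error f fm z j = f (z (Suc j)) - fm j (z (Suc j))"

text \<open>Both values are finite in the setting of interest (by the two lemmas above), so
  \<open>real_of_ereal\<close> does not lose information.\<close>

definition prox_gap ::
  "('a::real_inner \<Rightarrow> real) \<Rightarrow> ('a \<Rightarrow> ereal) \<Rightarrow> real \<Rightarrow> 'a \<Rightarrow>
   (nat \<Rightarrow> 'a \<Rightarrow> real) \<Rightarrow> nat \<Rightarrow> real" where
  "prox_gap f h \<rho> xbar fm j =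
     real_of_ereal (prox_value (composite f h) \<rho> xbar)
     - real_of_ereal (prox_value (composite (fm j) h) \<rho> xbar)"

definition holder_G :: "real \<Rightarrow> real \<Rightarrow> real" where
  "holder_G \<nu> L = (L / (1 + \<nu>)) powr (- (2 / (1 + \<nu>)))"

text \<open>The constant hidden in the asymptotic bound, for \<open>\<nu> < 1\<close>. It is given explicitly
  because an existentially quantified constant could depend on the type, that is on the
  dimension of the space. Its value is the factor that remains of
  \<open>(4 * (1 + \<nu>) / ((1 - \<nu>) * \<rho> * holder_G \<nu> L * t)) powr ((1 + \<nu>) / (1 - \<nu>))\<close>
  after splitting off the powers of \<open>L\<close>, \<open>\<rho>\<close> and \<open>t\<close>.\<close>

definition hidden_const :: "real \<Rightarrow> real" where
  "hidden_const \<nu> =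
     (4 * (1 + \<nu>) / (1 - \<nu>)) powr ((1 + \<nu>) / (1 - \<nu>)) * (1 + \<nu>) powr (- (2 / (1 - \<nu>)))"

end

theory Submission
  imports Defs "HOL-Real_Asymp.Real_Asymp"
begin

text \<open>Aggregation makes the model values grow, \<open>m (j+1) \<ge> m j + \<rho>/2 * |z (j+2) - z (j+1)|^2\<close>,
  while linearisation at \<open>z (j+1)\<close> and Hoelder smoothness bound the model error \<open>e (j+1)\<close> by
  \<open>L/(1+\<nu>) * |z (j+2) - z (j+1)|^(1+\<nu>)\<close>. Since \<open>0 \<le> \<delta> j \<le> e j\<close>, this gives
  \<open>c * e (j+1)^p \<le> \<delta> j - \<delta> (j+1)\<close> with \<open>p = 2/(1+\<nu>)\<close> and \<open>c = \<rho> * G / 2\<close>. For \<open>p = 1\<close> the gaps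
  decay geometrically. For \<open>p > 1\<close>, telescoping over \<open>t, ..., 2t-1\<close> bounds the smallest error by
  the gap \<open>\<delta> t\<close>, and the recursion \<open>\<delta> (j+1) + c * \<delta> (j+1)^p \<le> \<delta> j\<close> increases the potential
  \<open>\<delta>^(1-p) / ((p-1) * c) - ln \<delta>\<close> by at least 1 per step, so one of its two terms accounts for
  \<open>t/2\<close> after \<open>t\<close> steps; these are the two terms of the maximum.\<close>

text \<open>Weighted AM-GM for \<open>a\<close> and 1 with weights \<open>q\<close> and
  \<open>1 - q\<close>.\<close>

lemma powr_le_tangent_at_1:
  fixes a q :: real
  assumes "0 < a" "0 \<le> q" "q \<le> 1"
  shows "a powr q \<le> 1 + q * (a - 1)"
  using Youngs_inequality_0[of q "1 - q" a 1] assms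
  by (simp add: algebra_simps)

section \<open>Subgradients of real-valued convex functions and Hoelder descent\<close>

lemma subdifferential_real_iff:
  "g \<in> subdifferential (\<lambda>x. ereal (f x)) x \<longleftrightarrow> (\<forall>y. f x + g \<bullet> (y - x) \<le> f y)"
  by (simp add: subdifferential_def)

text \<open>A hyperplane separates \<open>(x, f x)\<close> from the strict epigraph
  \<open>S\<close>. It is not vertical, so dividing its normal by the last coordinate yields a
  subgradient.\<close>

lemma subdifferential_nonempty:
  fixes f :: "'a::euclidean_space \<Rightarrow> real"
  assumes "convex_on UNIV f"
  shows "subdifferential (\<lambda>x. ereal (f x)) x \<noteq> {}"
proof -
  define S where "S = {p :: 'a \<times> real. f (fst p) < snd p}"
  have "convex S"
  proof (rule convexI)
    fix p q :: "'a \<times> real" and u v :: real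
    assume pq: "p \<in> S" "q \<in> S" and uv: "0 \<le> u" "0 \<le> v" "u + v = 1"
    have "f (u *\<^sub>R fst p + v *\<^sub>R fst q) \<le> u * f (fst p) + v * f (fst q)"
      using assms uv by (auto simp: convex_on_def)
    also have "\<dots> < u * snd p + v * snd q"
    \<comment> \<open>Strictness has to come from a term with positive weight; for
      \<open>u = 0\<close> only the second one has it.\<close>
    proof (cases "u = 0")
      case True
      then show ?thesis using pq uv by (simp add: S_def)
    next
      case False
      then show ?thesis using pq uv
        by (intro add_less_le_mono mult_strict_left_mono mult_left_mono) (auto simp: S_def)
    qed
    finally show "u *\<^sub>R p + v *\<^sub>R q \<in> S" by (simp add: S_def)
  qed
  moreover have "(x, f x + 1) \<in> S" "(x, f x) \<notin> S" by (auto simp: S_def)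
  ultimately have "\<exists>n b. n \<noteq> 0 \<and> (\<forall>p\<in>S. n \<bullet> p \<le> b) \<and> (\<forall>p\<in>{(x, f x)}. b \<le> n \<bullet> p)"
    by (intro separating_hyperplane_sets) auto
  then obtain n b where n: "n \<noteq> 0" "\<forall>p\<in>S. n \<bullet> p \<le> b" "b \<le> n \<bullet> (x, f x)"
    by blast
  obtain a \<beta> where ab: "n = (a, \<beta>)" by (cases n)
  have sep: "a \<bullet> y + \<beta> * r \<le> a \<bullet> x + \<beta> * f x" if "f y < r" for y r
    using n(2)[rule_format, of "(y, r)"] n(3) that by (simp add: S_def ab inner_prod_def)
  have "\<beta> \<le> 0"
    using sep[of x "f x + 1"] by (simp add: algebra_simps)
  \<comment> \<open>A vertical hyperplane would have to bound \<open>a \<bullet> y\<close> over all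
    \<open>y\<close>, as \<open>f\<close> is finite everywhere.\<close>
  moreover have "\<beta> \<noteq> 0"
  proof
    assume "\<beta> = 0"
    then have "a \<bullet> a \<le> 0"
      using sep[of "x + a" "f (x + a) + 1"] by (simp add: inner_add_right)
    then have "a = 0" by (metis inner_ge_zero inner_eq_zero_iff order_antisym)
    with \<open>\<beta> = 0\<close> n(1) ab show False by (simp add: zero_prod_def)
  qed
  ultimately have neg: "\<beta> < 0" by simp
  have "f x + (- (1 / \<beta>) *\<^sub>R a) \<bullet> (y - x) \<le> f y" for y
  \<comment> \<open>Separation only covers heights strictly above \<open>f y\<close>, hence the
    passage to the limit.\<close>
  proof (rule dense_ge)
    fix r assume "f y < r"
    from sep[OF this] neg show "f x + (- (1 / \<beta>) *\<^sub>R a) \<bullet> (y - x) \<le> r"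
      by (simp add: field_simps inner_diff_right)
  qed
  then have "- (1 / \<beta>) *\<^sub>R a \<in> subdifferential (\<lambda>x. ereal (f x)) x"
    unfolding subdifferential_real_iff by blast
  then show ?thesis by blast
qed

text \<open>For \<open>\<nu> > 0\<close>, Hoelder continuity of the subgradients makes
  \<open>f\<close> differentiable along the segment, and the claim is the integrated bound on the
  growth of the slope. For \<open>\<nu> = 0\<close>, where \<open>f\<close> may have kinks, one
  subgradient at \<open>y\<close> suffices.\<close>

lemma holder_descent:
  fixes f :: "'a::euclidean_space \<Rightarrow> real"
  assumes conv: "convex_on UNIV f" and \<nu>: "0 \<le> \<nu>" and "L > 0"
    and hs: "holder_smooth \<nu> L f"
    and g: "g \<in> subdifferential (\<lambda>x. ereal (f x)) x"
  shows "f y \<le> f x + g \<bullet> (y - x) + L / (1 + \<nu>) * norm (y - x) powr (1 + \<nu>)"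
proof (cases "\<nu> = 0")
  case True
  obtain k where k: "k \<in> subdifferential (\<lambda>x. ereal (f x)) y"
    using subdifferential_nonempty[OF conv] by blast
  have "f y \<le> f x + k \<bullet> (y - x)"
    using k by (auto simp: subdifferential_real_iff inner_diff_right dest: spec[of _ x])
  moreover have "(k - g) \<bullet> (y - x) \<le> L * norm (y - x)"
    using hs k g True by (intro order_trans[OF norm_cauchy_schwarz] mult_right_mono)
      (auto simp: holder_smooth_def)
  ultimately show ?thesis using True by (simp add: inner_diff_left powr_one)
next
  case False
  with \<nu> have pos: "\<nu> > 0" by simp
  define d where "d = y - x"
  define \<phi> where "\<phi> s = f (x + s *\<^sub>R d)" for s
  \<comment> \<open>Hoelder constant of the slope along the line: \<open>norm d powr \<nu>\<close>
    comes from smoothness, a further \<open>norm d\<close> from Cauchy-Schwarz.\<close>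
  define D where "D = L * norm d powr (1 + \<nu>)"
  have "\<exists>k. \<forall>s. k s \<in> subdifferential (\<lambda>x. ereal (f x)) (x + s *\<^sub>R d)"
    by (rule choice) (use subdifferential_nonempty[OF conv] in blast)
  then obtain k where k: "\<And>s. k s \<in> subdifferential (\<lambda>x. ereal (f x)) (x + s *\<^sub>R d)" by blast
  have slope: "\<phi> s + (r - s) * (k s \<bullet> d) \<le> \<phi> r" for s r
    using k[of s, unfolded subdifferential_real_iff, rule_format, of "x + r *\<^sub>R d"]
    by (simp add: \<phi>_def flip: scaleR_left_diff_distrib)
  have osc: "\<bar>(k' - k'') \<bullet> d\<bar> \<le> D * \<bar>r - s\<bar> powr \<nu>"
    if "k' \<in> subdifferential (\<lambda>x. ereal (f x)) (x + r *\<^sub>R d)"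
      "k'' \<in> subdifferential (\<lambda>x. ereal (f x)) (x + s *\<^sub>R d)" for k' k'' r s
  proof -
    have "\<bar>(k' - k'') \<bullet> d\<bar> \<le> norm (k' - k'') * norm d"
      by (rule Cauchy_Schwarz_ineq2)
    also have "\<dots> \<le> (L * norm ((r - s) *\<^sub>R d) powr \<nu>) * norm d"
      using hs that pos unfolding holder_smooth_def
      by (intro mult_right_mono)
        (fastforce simp: scaleR_left_diff_distrib)+
    also have "\<dots> = D * \<bar>r - s\<bar> powr \<nu>"
      by (simp add: D_def powr_mult powr_add mult_ac)
    finally show ?thesis .
  qed
  \<comment> \<open>The subgradient inequalities at \<open>s\<close> and at \<open>r\<close> trap
    the difference quotient between the two slopes, whose distance tends to 0 by \<open>osc\<close>.
    So the arbitrarily chosen \<open>k s\<close> gives the derivative.\<close>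
  have deriv: "(\<phi> has_real_derivative k s \<bullet> d) (at s)" for s
  proof -
    have "((\<lambda>r. (\<phi> r - \<phi> s) / (r - s) - k s \<bullet> d) \<longlongrightarrow> 0) (at s)"
    proof (rule Lim_null_comparison)
      show "\<forall>\<^sub>F r in at s. norm ((\<phi> r - \<phi> s) / (r - s) - k s \<bullet> d) \<le> D * \<bar>r - s\<bar> powr \<nu>"
        unfolding eventually_at_filter
      proof (intro always_eventually allI impI)
        fix r assume "r \<noteq> s"
        have "\<bar>\<phi> r - \<phi> s - (r - s) * (k s \<bullet> d)\<bar> \<le> \<bar>(r - s) * ((k r - k s) \<bullet> d)\<bar>"
          using slope[of s r] slope[of r s] by (simp add: inner_diff_left algebra_simps)
        also have "\<dots> \<le> \<bar>r - s\<bar> * (D * \<bar>r - s\<bar> powr \<nu>)"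
          unfolding abs_mult by (intro mult_left_mono osc k) auto
        finally have "\<bar>\<phi> r - \<phi> s - (r - s) * (k s \<bullet> d)\<bar> / \<bar>r - s\<bar> \<le> D * \<bar>r - s\<bar> powr \<nu>"
          using \<open>r \<noteq> s\<close> by (simp add: field_simps)
        then show "norm ((\<phi> r - \<phi> s) / (r - s) - k s \<bullet> d) \<le> D * \<bar>r - s\<bar> powr \<nu>"
          using \<open>r \<noteq> s\<close> by (simp add: diff_divide_distrib flip: abs_divide)
      qed
      have "((\<lambda>r. D * \<bar>r - s\<bar> powr \<nu>) \<longlongrightarrow> D * \<bar>s - s\<bar> powr \<nu>) (at s)"
        using pos by (intro tendsto_intros tendsto_powr') auto
      then show "((\<lambda>r. D * \<bar>r - s\<bar> powr \<nu>) \<longlongrightarrow> 0) (at s)" using pos by simp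
    qed
    then show ?thesis
      by (simp add: has_field_derivative_iff LIM_zero_iff)
  qed
  \<comment> \<open>Up to a constant, \<open>\<psi>\<close> is \<open>\<phi>\<close> minus the
    claimed upper bound along the segment. Its derivative is needed only for \<open>s > 0\<close>,
    where \<open>powr\<close> is differentiable; at the endpoints continuity is enough.\<close>
  define \<psi> where "\<psi> s = \<phi> s - s * (g \<bullet> d) - D / (1 + \<nu>) * s powr (1 + \<nu>)" for s
  have "\<psi> 1 \<le> \<psi> 0"
  proof (rule DERIV_nonpos_imp_decreasing_open[of 0 1 \<psi>])
    fix s :: real assume s: "0 < s" "s < 1"
    have "(\<psi> has_real_derivative k s \<bullet> d - g \<bullet> d - D / (1 + \<nu>) * ((1 + \<nu>) * s powr \<nu>)) (at s)"
      unfolding \<psi>_def using s by (auto intro!: derivative_eq_intros deriv)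
    moreover have "k s \<bullet> d - g \<bullet> d - D / (1 + \<nu>) * ((1 + \<nu>) * s powr \<nu>) \<le> 0"
      using osc[OF k[of s], of g 0] g s pos by (simp add: inner_diff_left)
    ultimately show "\<exists>y. (\<psi> has_real_derivative y) (at s) \<and> y \<le> 0"
      by blast
  next
    have "continuous_on {0..1} \<phi>"
      by (rule DERIV_continuous_on) (use deriv has_field_derivative_at_within in blast)
    then show "continuous_on {0..1} \<psi>"
      unfolding \<psi>_def using pos by (intro continuous_intros continuous_on_powr') auto
  qed simp
  then show ?thesis by (simp add: \<psi>_def \<phi>_def d_def D_def field_simps)
qed

section \<open>One step of the bundle method: model values, gaps and errors\<close>

locale bundle_run =
  fixes f :: "'a::euclidean_space \<Rightarrow> real" and h :: "'a \<Rightarrow> ereal" and \<rho> :: real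
    and xbar :: 'a and fm :: "nat \<Rightarrow> 'a \<Rightarrow> real" and z :: "nat \<Rightarrow> 'a"
  assumes proper: "proper_fun h"
    and minimum: "\<exists>x. is_arg_min (composite f h) (\<lambda>_. True) x"
    and rho_pos: "\<rho> > 0"
    and center: "xbar \<in> effective_domain (composite f h)"
    and run: "prox_bundle f h \<rho> xbar fm z"
begin

definition hval :: "nat \<Rightarrow> real" where
  "hval j = real_of_ereal (h (z (Suc j)))"

text \<open>The real number \<open>m j\<close> of the overview; \<open>prox_value_model\<close>
  identifies it with the optimal value of the subproblem for \<open>fm j\<close>.\<close>

definition model_value :: "nat \<Rightarrow> real" where
  "model_value j = fm j (z (Suc j)) + hval j + \<rho> / 2 * (norm (z (Suc j) - xbar))\<^sup>2"

lemma model_le: "fm j x \<le> f x"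
  using run by (auto simp: prox_bundle_def)

lemma next_arg_min:
  "prox_objective (composite (fm j) h) \<rho> xbar (z (Suc j))
     \<le> prox_objective (composite (fm j) h) \<rho> xbar x"
  using run by (auto simp: prox_bundle_def is_arg_min_linorder)

text \<open>Comparison of the minimiser with \<open>xbar\<close>, where the objective is finite,
  excludes \<open>\<infinity>\<close>.\<close>

lemma h_next: "h (z (Suc j)) = ereal (hval j)"
proof -
  have "h xbar < \<infinity>"
    using center by (simp add: effective_domain_def composite_def)
  then have "prox_objective (composite (fm j) h) \<rho> xbar xbar < \<infinity>"
    by (simp add: prox_objective_def composite_def)
  then have "prox_objective (composite (fm j) h) \<rho> xbar (z (Suc j)) < \<infinity>"
    using next_arg_min[of j xbar] by (rule le_less_trans[rotated])
  then have "h (z (Suc j)) < \<infinity>"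
    by (simp add: prox_objective_def composite_def)
  moreover have "h (z (Suc j)) \<noteq> -\<infinity>"
    using proper by (simp add: proper_fun_def)
  ultimately show ?thesis
    by (auto simp: hval_def ereal_real)
qed

lemma prox_value_model: "prox_value (composite (fm j) h) \<rho> xbar = ereal (model_value j)"
proof -
  have "is_arg_min (prox_objective (composite (fm j) h) \<rho> xbar) (\<lambda>_. True) (z (Suc j))"
    using run by (simp add: prox_bundle_def)
  from prox_value_eq_minimum[OF this] show ?thesis
    by (simp add: prox_objective_def composite_def h_next model_value_def)
qed

lemma prox_value_true_finite: "\<bar>prox_value (composite f h) \<rho> xbar\<bar> \<noteq> \<infinity>"
proof (rule prox_value_finite[OF _ minimum rho_pos])
  show "proper_fun (composite f h)"
    using proper center by (auto simp: proper_fun_def composite_def)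
qed

lemma prox_gap_nonneg: "0 \<le> prox_gap f h \<rho> xbar fm j"
proof -
  have "prox_value (composite (fm j) h) \<rho> xbar \<le> prox_value (composite f h) \<rho> xbar"
    unfolding prox_value_def prox_objective_def composite_def
    by (intro INF_mono' add_right_mono) (simp add: model_le)
  then show ?thesis
    using prox_value_true_finite by (auto simp: prox_gap_def prox_value_model)
qed

text \<open>The model minimiser is a candidate for the true proximal problem, and there the two
  objectives differ exactly by the model error.\<close>

lemma prox_gap_le_model_error: "prox_gap f h \<rho> xbar fm j \<le> model_error f fm z j"
proof -
  have "prox_value (composite f h) \<rho> xbar \<le> prox_objective (composite f h) \<rho> xbar (z (Suc j))"
    by (simp add: prox_value_def INF_lower)
  then have "real_of_ereal (prox_value (composite f h) \<rho> xbar)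
      \<le> f (z (Suc j)) + hval j + \<rho> / 2 * (norm (z (Suc j) - xbar))\<^sup>2"
    using prox_value_true_finite by (auto simp: prox_objective_def composite_def h_next)
  then show ?thesis
    by (simp add: prox_gap_def prox_value_model model_value_def model_error_def)
qed

text \<open>The aggregate cut and the subgradient inequality for \<open>h\<close> have slopes adding
  up to \<open>\<rho> *\<^sub>R (xbar - z (Suc j))\<close>. This cancels the linear term of the
  proximal quadratic expanded around \<open>z (Suc j)\<close>, leaving only the squared
  step.\<close>

lemma model_value_increase:
  "model_value j + \<rho> / 2 * (norm (z (Suc (Suc j)) - z (Suc j)))\<^sup>2 \<le> model_value (Suc j)"
proof -
  let ?x = "z (Suc j)" and ?y = "z (Suc (Suc j))"
  obtain a b where b: "b \<in> subdifferential h ?x" and ab: "a + b = \<rho> *\<^sub>R (xbar - ?x)"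
    and a: "fm j ?x + a \<bullet> (?y - ?x) \<le> fm (Suc j) ?y"
    using run unfolding prox_bundle_def by (metis One_nat_def diff_Suc_1 le_add1 plus_1_eq_Suc)
  have "hval j + b \<bullet> (?y - ?x) \<le> hval (Suc j)"
    using b unfolding subdifferential_def by (auto simp: h_next dest: spec[of _ ?y])
  moreover have "a \<bullet> (?y - ?x) + b \<bullet> (?y - ?x) = \<rho> * ((xbar - ?x) \<bullet> (?y - ?x))"
    by (simp add: ab flip: inner_add_left)
  moreover have "\<rho> / 2 * (norm (?y - xbar))\<^sup>2 = \<rho> / 2 * (norm (?x - xbar))\<^sup>2
      + \<rho> / 2 * (norm (?y - ?x))\<^sup>2 - \<rho> * ((xbar - ?x) \<bullet> (?y - ?x))"
  proof -
    have "(norm (?y - xbar))\<^sup>2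
        = (norm (?x - xbar))\<^sup>2 + (norm (?y - ?x))\<^sup>2 - 2 * ((xbar - ?x) \<bullet> (?y - ?x))"
      by (simp add: power2_norm_eq_inner inner_diff_left inner_diff_right inner_commute)
    then show ?thesis
      by (simp only: right_diff_distrib distrib_left)
  qed
  ultimately show ?thesis
    using a unfolding model_value_def by linarith
qed

lemma prox_gap_decrease:
  "\<rho> / 2 * (norm (z (Suc (Suc j)) - z (Suc j)))\<^sup>2
     \<le> prox_gap f h \<rho> xbar fm j - prox_gap f h \<rho> xbar fm (Suc j)"
  using model_value_increase[of j] by (simp add: prox_gap_def prox_value_model)

text \<open>The cut at \<open>z (Suc j)\<close> bounds the next model error by a linearisation error
  of \<open>f\<close>. The power \<open>2 / (1 + \<nu>)\<close> turns the descent bound into a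
  multiple of the squared step, and \<open>holder_G\<close> is the reciprocal of its
  coefficient.\<close>

lemma model_error_powr_le:
  assumes conv: "convex_on UNIV f" and \<nu>: "0 \<le> \<nu>" and L: "L > 0"
    and hs: "holder_smooth \<nu> L f"
  shows "\<rho> * holder_G \<nu> L / 2 * model_error f fm z (Suc j) powr (2 / (1 + \<nu>))
    \<le> prox_gap f h \<rho> xbar fm j - prox_gap f h \<rho> xbar fm (Suc j)"
proof -
  let ?x = "z (Suc j)" and ?y = "z (Suc (Suc j))" and ?e = "model_error f fm z (Suc j)"
  obtain g where g: "g \<in> subdifferential (\<lambda>x. ereal (f x)) ?x"
      "f ?x + g \<bullet> (?y - ?x) \<le> fm (Suc j) ?y"
    using run unfolding prox_bundle_def by blast
  have "?e \<le> L / (1 + \<nu>) * norm (?y - ?x) powr (1 + \<nu>)"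
    using holder_descent[OF conv \<nu> L hs g(1), of ?y] g(2) by (simp add: model_error_def)
  moreover have "0 \<le> ?e"
    by (simp add: model_error_def model_le)
  ultimately have "?e powr (2 / (1 + \<nu>))
      \<le> (L / (1 + \<nu>) * norm (?y - ?x) powr (1 + \<nu>)) powr (2 / (1 + \<nu>))"
    using \<nu> by (intro powr_mono2) auto
  also have "\<dots> = (L / (1 + \<nu>)) powr (2 / (1 + \<nu>)) * (norm (?y - ?x))\<^sup>2"
  proof -
    have "(1 + \<nu>) * (2 / (1 + \<nu>)) = 2"
      using \<nu> by (simp add: field_simps)
    then show ?thesis
      by (simp only: powr_mult powr_powr) simp
  qed
  finally have "holder_G \<nu> L * ?e powr (2 / (1 + \<nu>)) \<le> (norm (?y - ?x))\<^sup>2"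
    using \<nu> L by (simp add: holder_G_def powr_minus field_simps)
  then have "\<rho> / 2 * (holder_G \<nu> L * ?e powr (2 / (1 + \<nu>))) \<le> \<rho> / 2 * (norm (?y - ?x))\<^sup>2"
    using rho_pos by (intro mult_left_mono) auto
  with prox_gap_decrease[of j] show ?thesis by (simp add: mult_ac)
qed

end

section \<open>Scalar recursions for gaps and errors\<close>

text \<open>As \<open>d\<close> lies below \<open>e\<close>, each step shrinks \<open>d\<close> by
  the factor \<open>1 + c\<close>. One more use of the step bounds the next error by the gap, which
  costs \<open>1 / c\<close> and the index shift.\<close>

lemma linear_decay:
  fixes d e :: "nat \<Rightarrow> real" and c :: real
  assumes c: "0 < c" and le: "\<And>j. 0 \<le> d j" "\<And>j. d j \<le> e j"
    and step: "\<And>j. c * e (Suc j) \<le> d j - d (Suc j)"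
  shows "e (Suc j) \<le> 1 / c * (1 + c) powi (- int j) * d 0"
proof -
  have "(1 + c) ^ j * d j \<le> d 0"
  proof (induction j)
    case (Suc j)
    have "(1 + c) * d (Suc j) \<le> d j"
      using step[of j] mult_left_mono[OF le(2)[of "Suc j"], of c] c
      unfolding distrib_right by linarith
    then have "(1 + c) ^ j * ((1 + c) * d (Suc j)) \<le> (1 + c) ^ j * d j"
      using c by (intro mult_left_mono) auto
    with Suc show ?case by (simp add: mult_ac)
  qed simp
  then have "d j \<le> (1 + c) powi (- int j) * d 0"
    using c by (simp add: power_int_minus field_simps)
  moreover have "e (Suc j) \<le> 1 / c * d j"
    using step[of j] le(1)[of "Suc j"] c by (simp add: field_simps)
  ultimately show ?thesis
    using c mult_left_mono[of "d j" "(1 + c) powi (- int j) * d 0" "1 / c"] by (simp add: mult_ac)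
qed

text \<open>Writing \<open>y = c * b powr q\<close> for the relative decrease, the two terms on the right grow by
  at least \<open>(1 - (1 + y) powr (- q)) / (q * y) \<ge> 1 / (1 + y)\<close> and \<open>ln (1 + y)\<close> respectively,
  and \<open>1 / (1 + y) + ln (1 + y) \<ge> 1\<close>.\<close>

lemma recursion_potential_step:
  fixes a b c q :: real
  assumes "0 < b" "0 < c" "0 < q" "q \<le> 1" and step: "b + c * b powr (1 + q) \<le> a"
  shows "1 \<le> (b powr (- q) - a powr (- q)) / (q * c) + (ln a - ln b)"
proof -
  define y where "y = c * b powr q"
  have y: "y > 0" using assms by (simp add: y_def)
  have a: "b * (1 + y) \<le> a"
    using step \<open>0 < b\<close> by (simp add: y_def powr_add algebra_simps)
  then have a_pos: "a > 0" using y \<open>0 < b\<close> by (smt (verit) mult_pos_pos)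
  have "ln b + ln (1 + y) \<le> ln a"
    using a y \<open>0 < b\<close> a_pos by (simp flip: ln_mult_pos)
  moreover have "1 - 1 / (1 + y) \<le> ln (1 + y)"
    using ln_le_minus_one[of "1 / (1 + y)"] y by (simp add: ln_div)
  moreover have "1 / (1 + y) \<le> (b powr (- q) - a powr (- q)) / (q * c)"
  proof -
    have "a powr (- q) \<le> (b * (1 + y)) powr (- q)"
      using a y \<open>0 < b\<close> \<open>0 < q\<close> by (intro powr_mono2') auto
    also have "\<dots> = b powr (- q) * (1 / (1 + y)) powr q"
      using y \<open>0 < b\<close> by (simp add: powr_mult powr_minus_divide powr_divide)
    also have "\<dots> \<le> b powr (- q) * (1 + q * (1 / (1 + y) - 1))"
      using y assms by (intro mult_left_mono powr_le_tangent_at_1) auto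
    \<comment> \<open>Here \<open>1 / (1 + y) - 1 = - y / (1 + y)\<close>, and
      \<open>b powr (- q) * y = c\<close> removes \<open>b\<close>.\<close>
    also have "\<dots> = b powr (- q) - q * c / (1 + y)"
      using y \<open>0 < b\<close> by (simp add: y_def powr_minus field_simps)
    finally show ?thesis
      using assms y by (simp add: field_simps)
  qed
  ultimately show ?thesis by linarith
qed

lemma recursion_bound:
  fixes d :: "nat \<Rightarrow> real" and c q :: real
  assumes c: "0 < c" and q: "0 < q" "q \<le> 1" and nonneg: "\<And>j. 0 \<le> d j"
    and step: "\<And>j. d (Suc j) + c * d (Suc j) powr (1 + q) \<le> d j"
    and "t \<ge> 1"
  shows "d t \<le> max (d 0 * exp (- (real t / 2))) ((2 / (q * c * real t)) powr (1 / q))"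
\<comment> \<open>The potential needs positive gaps; by monotonicity \<open>d t > 0\<close> ensures
  this for all earlier indices.\<close>
proof (cases "d t = 0")
  case True
  then show ?thesis by (simp add: le_max_iff_disj)
next
  case False
  then have dt: "0 < d t" using nonneg[of t] by linarith
  have "d (Suc j) \<le> d j" for j
    using step[of j] c by (smt (verit) mult_nonneg_nonneg powr_ge_zero)
  then have "d t \<le> d j" if "j \<le> t" for j
    using lift_Suc_antimono_le[of d] that by blast
  with dt have pos: "0 < d j" if "j \<le> t" for j
    using that by (meson less_le_trans)
  have potential: "real j \<le> (d j powr (- q) - d 0 powr (- q)) / (q * c) + (ln (d 0) - ln (d j))"
    if "j \<le> t" for j
    using that
  proof (induction j)
    case (Suc j)
    then show ?case
      using recursion_potential_step[OF pos[of "Suc j"] c q step[of j]]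
      by (simp add: diff_divide_distrib)
  qed simp
  have "0 \<le> d 0 powr (- q) / (q * c)"
    using c q by simp
  \<comment> \<open>After dropping the initial power term the two summands still total at least
    \<open>t\<close>.\<close>
  then have "d t powr (- q) / (q * c) \<ge> real t / 2 \<or> ln (d 0) - ln (d t) \<ge> real t / 2"
    using potential[of t] unfolding diff_divide_distrib by linarith
  then show ?thesis
  proof
    assume "d t powr (- q) / (q * c) \<ge> real t / 2"
    then have "d t powr q \<le> 2 / (q * c * real t)"
      using c q dt \<open>t \<ge> 1\<close> by (simp add: powr_minus field_simps)
    then have "(d t powr q) powr (1 / q) \<le> (2 / (q * c * real t)) powr (1 / q)"
      using q by (intro powr_mono2) auto
    then show ?thesis using q dt by (simp add: powr_powr)
  next
    assume "ln (d 0) - ln (d t) \<ge> real t / 2"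
    then have "exp (ln (d t)) \<le> exp (ln (d 0) + - (real t / 2))"
      by simp
    then have "d t \<le> d 0 * exp (- (real t / 2))"
      unfolding exp_add using dt pos[of 0] by simp
    then show ?thesis by simp
  qed
qed

text \<open>Passing from \<open>d t\<close> to the averaged root loses nothing: a root
  \<open>x\<close> above the second term satisfies
  \<open>c * t * x powr q \<ge> 2 / q \<ge> 2\<close>, whence
  \<open>x \<le> c * t * x powr (1 + q) = d t\<close>, and \<open>recursion_bound\<close> applies to
  \<open>d t\<close>.\<close>

lemma recursion_bound_root:
  fixes d :: "nat \<Rightarrow> real" and c q :: real
  assumes c: "0 < c" and q: "0 < q" "q \<le> 1" and nonneg: "\<And>j. 0 \<le> d j"
    and step: "\<And>j. d (Suc j) + c * d (Suc j) powr (1 + q) \<le> d j"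
    and t: "t \<ge> 1"
  shows "(d t / (c * real t)) powr (1 / (1 + q))
    \<le> max (d 0 * exp (- (real t / 2))) ((2 / (q * c * real t)) powr (1 / q))"
    (is "?x \<le> max ?E ?B")
proof (rule ccontr)
  assume "\<not> ?x \<le> max ?E ?B"
  then have x: "?E < ?x" "?B < ?x" by auto
  have x0: "?x > 0"
    using x(2) by (rule le_less_trans[OF powr_ge_zero])
  have "2 \<le> 2 / q" using q by (simp add: field_simps)
  also have "2 / q = c * real t * ?B powr q"
    using c q t by (simp add: powr_powr)
  also have "\<dots> \<le> c * real t * ?x powr q"
    using x(2) c q by (intro mult_left_mono powr_mono2) auto
  finally have "1 * ?x \<le> c * real t * ?x powr q * ?x"
    using x0 by (intro mult_right_mono) auto
  also have "\<dots> = c * real t * ?x powr (1 + q)"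
    using x0 by (simp add: powr_add)
  also have "\<dots> = d t"
    using c q t nonneg[of t] by (simp add: powr_powr)
  finally have "?x \<le> d t" by simp
  with x recursion_bound[of c q d t, OF c q nonneg step t] show False by linarith
qed

text \<open>The steps from \<open>t\<close> to \<open>2 * t - 1\<close> involve exactly the errors
  at \<open>t + 1\<close> to \<open>2 * t\<close>. Each costs at least the minimum, and together
  they cost at most \<open>d t\<close> because \<open>d\<close> stays nonnegative.\<close>

lemma Min_powr_le_average:
  fixes d e :: "nat \<Rightarrow> real" and c p :: real
  assumes c: "0 < c" and p: "0 < p" and nonneg: "\<And>j. 0 \<le> d j" "\<And>j. 0 \<le> e j"
    and step: "\<And>j. c * e (Suc j) powr p \<le> d j - d (Suc j)"
    and t: "t \<ge> 1"
  shows "Min (e ` {t + 1..2 * t}) \<le> (d t / (c * real t)) powr (1 / p)"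
proof -
  let ?M = "Min (e ` {t + 1..2 * t})"
  have ne: "e ` {t + 1..2 * t} \<noteq> {}" using t by simp
  then have M0: "0 \<le> ?M" using nonneg(2) by (subst Min_ge_iff) auto
  have "real k * (c * ?M powr p) \<le> d t - d (t + k)" if "k \<le> t" for k
    using that
  proof (induction k)
    case (Suc k)
    have "?M \<le> e (Suc (t + k))"
      using Suc.prems by (intro Min_le) auto
    then have "c * ?M powr p \<le> c * e (Suc (t + k)) powr p"
      using M0 c p by (intro mult_left_mono powr_mono2) auto
    with Suc step[of "t + k"] show ?case by (simp add: algebra_simps)
  qed simp
  from this[of t] nonneg(1)[of "t + t"] have "?M powr p \<le> d t / (c * real t)"
    using c t by (simp add: field_simps)
  then have "(?M powr p) powr (1 / p) \<le> (d t / (c * real t)) powr (1 / p)"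
    using p by (intro powr_mono2) auto
  then show ?thesis using p M0 by (simp add: powr_powr)
qed

section \<open>Explicit constants and the asymptotic rate\<close>

lemma rate_bound_eq_hidden_const:
  assumes "0 \<le> \<nu>" "\<nu> < 1"
  shows "(4 * (1 + \<nu>) / ((1 - \<nu>) * \<rho> * holder_G \<nu> L * t)) powr ((1 + \<nu>) / (1 - \<nu>))
    = hidden_const \<nu> * (L powr (2 / (1 - \<nu>)) * \<rho> powr (- ((1 + \<nu>) / (1 - \<nu>)))
        * t powr (- ((1 + \<nu>) / (1 - \<nu>))))"
proof -
  define r where "r = (1 + \<nu>) / (1 - \<nu>)"
  \<comment> \<open>Source of the exponent of \<open>L\<close>, and of the factor in
    \<open>1 + \<nu>\<close> in \<open>hidden_const\<close>.\<close>
  have "2 / (1 + \<nu>) * r = 2 / (1 - \<nu>)"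
    using assms by (simp add: r_def del: distrib_left_numeral)
  then have "holder_G \<nu> L powr (- r) = (L / (1 + \<nu>)) powr (2 / (1 - \<nu>))"
    unfolding holder_G_def powr_powr by simp
  also have "\<dots> = L powr (2 / (1 - \<nu>)) * (1 + \<nu>) powr (- (2 / (1 - \<nu>)))"
    by (simp add: powr_divide powr_minus_divide)
  finally have G: "holder_G \<nu> L powr (- r) = \<dots>" .
  have "4 * (1 + \<nu>) / ((1 - \<nu>) * \<rho> * holder_G \<nu> L * t)
      = (4 * (1 + \<nu>) / (1 - \<nu>)) / (\<rho> * holder_G \<nu> L * t)"
    using assms by simp
  also have "\<dots> powr r = (4 * (1 + \<nu>) / (1 - \<nu>)) powr r
      * (\<rho> powr (- r) * holder_G \<nu> L powr (- r) * t powr (- r))"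
    by (simp add: powr_divide powr_mult powr_minus_divide)
  finally show ?thesis
    unfolding G by (simp add: hidden_const_def r_def mult_ac)
qed

text \<open>Makes the power term win the maximum for large \<open>t\<close>; the initial gap then
  affects only the threshold, not the constant.\<close>

lemma eventually_exp_le_powr:
  fixes A C r :: real
  assumes "0 < C"
  shows "\<forall>\<^sub>F t::nat in sequentially. A * exp (- (real t / 2)) \<le> C * real t powr (- r)"
proof -
  have "((\<lambda>t::nat. A * exp (- (real t / 2)) * real t powr r) \<longlongrightarrow> 0) sequentially"
    by real_asymp
  then have "\<forall>\<^sub>F t::nat in sequentially. A * exp (- (real t / 2)) * real t powr r < C"
    using assms by (rule order_tendstoD)
  then show ?thesis
    using eventually_gt_at_top[of "0::nat"]
    by eventually_elim (simp add: powr_minus field_simps)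
qed

theorem corollary2:
  fixes f :: "real ^ 'n \<Rightarrow> real"
    and h :: "real ^ 'n \<Rightarrow> ereal"
    and \<nu> L \<rho> :: real
    and xbar :: "real ^ 'n"
    and fm :: "nat \<Rightarrow> real ^ 'n \<Rightarrow> real"
    and z :: "nat \<Rightarrow> real ^ 'n"
    and e \<delta> :: "nat \<Rightarrow> real"
    and G :: real
  assumes "convex_on UNIV f"
    and "proper_fun h" and "lower_semicontinuous h" and "convex_ereal h"
    and "\<exists>x. is_arg_min (composite f h) (\<lambda>_. True) x"
    and "0 \<le> \<nu>" and "\<nu> \<le> 1" and "L > 0" and "holder_smooth \<nu> L f"
    and "\<rho> > 0" and "xbar \<in> effective_domain (composite f h)"
    and "prox_bundle f h \<rho> xbar fm z"
  defines "e \<equiv> model_error f fm z"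
    and "\<delta> \<equiv> prox_gap f h \<rho> xbar fm"
    and "G \<equiv> holder_G \<nu> L"
  shows "(\<nu> = 1 \<longrightarrow> (\<forall>j::nat. e (j + 1) \<le> L / \<rho> * (1 + \<rho> / L) powi (- int j) * \<delta> 0))
    \<and> (\<nu> < 1 \<longrightarrow>
         (\<forall>t::nat. t \<ge> 1 \<longrightarrow>
            Min (e ` {t + 1..2 * t}) \<le> (2 * \<delta> t / (\<rho> * G * real t)) powr ((1 + \<nu>) / 2)
            \<and> (2 * \<delta> t / (\<rho> * G * real t)) powr ((1 + \<nu>) / 2)
                \<le> max (\<delta> 0 * exp (- (real t / 2)))
                      ((4 * (1 + \<nu>) / ((1 - \<nu>) * \<rho> * G * real t)) powr ((1 + \<nu>) / (1 - \<nu>))))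
         \<and> (\<forall>\<^sub>F t::nat in sequentially.
              \<bar>Min (e ` {t + 1..2 * t})\<bar>
                \<le> hidden_const \<nu> * (L powr (2 / (1 - \<nu>)) * \<rho> powr (- ((1 + \<nu>) / (1 - \<nu>)))
                     * real t powr (- ((1 + \<nu>) / (1 - \<nu>))))))"
proof (intro conjI impI)
  interpret bundle_run f h \<rho> xbar fm z
    using assms by unfold_locales
  have \<delta>: "0 \<le> \<delta> j" "\<delta> j \<le> e j" for j
    unfolding \<delta>_def e_def by (rule prox_gap_nonneg prox_gap_le_model_error)+
  have e: "0 \<le> e j" for j
    using \<delta>[of j] by linarith
  define c where "c = \<rho> * G / 2"
  have c: "c > 0"
    using assms by (simp add: c_def G_def holder_G_def)
  have step: "c * e (Suc j) powr (2 / (1 + \<nu>)) \<le> \<delta> j - \<delta> (Suc j)" for j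
    using model_error_powr_le assms unfolding c_def e_def \<delta>_def G_def by blast
  {
    assume "\<nu> = 1"
    \<comment> \<open>For \<open>\<nu> = 1\<close> one has \<open>G = 2 / L\<close>, and the
      exponent \<open>2 / (1 + \<nu>)\<close> is 1.\<close>
    then have "c = \<rho> / L"
      using assms by (simp add: c_def G_def holder_G_def powr_minus)
    moreover have "e (Suc j) \<le> 1 / c * (1 + c) powi (- int j) * \<delta> 0" for j
      using step e \<open>\<nu> = 1\<close> by (intro linear_decay[OF c \<delta>]) simp
    ultimately show "\<forall>j. e (j + 1) \<le> L / \<rho> * (1 + \<rho> / L) powi (- int j) * \<delta> 0"
      by simp
  }
  assume "\<nu> < 1"
  \<comment> \<open>The excess of the exponent \<open>2 / (1 + \<nu>)\<close> over 1; its reciprocal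
    is the exponent of the rate.\<close>
  define q where "q = (1 - \<nu>) / (1 + \<nu>)"
  have q: "0 < q" "q \<le> 1" and q1: "1 + q = 2 / (1 + \<nu>)"
    using \<open>\<nu> < 1\<close> \<open>0 \<le> \<nu>\<close> by (auto simp: q_def field_simps)
  have inv: "1 / (1 + q) = (1 + \<nu>) / 2" "1 / q = (1 + \<nu>) / (1 - \<nu>)"
    using q1 by (simp_all add: q_def)
  \<comment> \<open>Replacing the error by the smaller gap closes the recursion in
    \<open>\<delta>\<close> alone.\<close>
  have rec: "\<delta> (Suc j) + c * \<delta> (Suc j) powr (1 + q) \<le> \<delta> j" for j
  proof -
    have "c * \<delta> (Suc j) powr (1 + q) \<le> c * e (Suc j) powr (1 + q)"
      using \<delta> c q by (intro mult_left_mono powr_mono2) auto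
    with step[of j] show ?thesis unfolding q1 by linarith
  qed
  have ratio: "\<delta> t / (c * real t) = 2 * \<delta> t / (\<rho> * G * real t)" for t
    by (simp add: c_def)
  have bound: "2 / (q * c * real t) = 4 * (1 + \<nu>) / ((1 - \<nu>) * \<rho> * G * real t)" for t
    by (simp add: c_def q_def)
  have main: "Min (e ` {t + 1..2 * t}) \<le> (2 * \<delta> t / (\<rho> * G * real t)) powr ((1 + \<nu>) / 2)
      \<and> (2 * \<delta> t / (\<rho> * G * real t)) powr ((1 + \<nu>) / 2)
          \<le> max (\<delta> 0 * exp (- (real t / 2)))
                ((4 * (1 + \<nu>) / ((1 - \<nu>) * \<rho> * G * real t)) powr ((1 + \<nu>) / (1 - \<nu>)))"
    if "t \<ge> 1" for t
    using Min_powr_le_average[of c "1 + q" \<delta> e t, OF c _ \<delta>(1) e step[folded q1] that]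
      recursion_bound_root[of c q \<delta> t, OF c q \<delta>(1) rec that] q
    by (simp add: inv ratio bound)
  then show "\<forall>t::nat. t \<ge> 1 \<longrightarrow>
      Min (e ` {t + 1..2 * t}) \<le> (2 * \<delta> t / (\<rho> * G * real t)) powr ((1 + \<nu>) / 2)
      \<and> (2 * \<delta> t / (\<rho> * G * real t)) powr ((1 + \<nu>) / 2)
          \<le> max (\<delta> 0 * exp (- (real t / 2)))
                ((4 * (1 + \<nu>) / ((1 - \<nu>) * \<rho> * G * real t)) powr ((1 + \<nu>) / (1 - \<nu>)))"
    by blast
  let ?r = "(1 + \<nu>) / (1 - \<nu>)"
  let ?C = "hidden_const \<nu> * (L powr (2 / (1 - \<nu>)) * \<rho> powr (- ?r))"
  have "?C > 0"
    using assms \<open>\<nu> < 1\<close> by (simp add: hidden_const_def)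
  from eventually_exp_le_powr[OF this] eventually_ge_at_top[of "1::nat"]
  show "\<forall>\<^sub>F t::nat in sequentially. \<bar>Min (e ` {t + 1..2 * t})\<bar>
      \<le> hidden_const \<nu> * (L powr (2 / (1 - \<nu>)) * \<rho> powr (- ?r) * real t powr (- ?r))"
  proof (rule eventually_elim2)
    fix t :: nat
    assume elim: "\<delta> 0 * exp (- (real t / 2)) \<le> ?C * real t powr (- ?r)" "1 \<le> t"
    have "Min (e ` {t + 1..2 * t}) \<in> e ` {t + 1..2 * t}"
      using elim(2) by (intro Min_in) auto
    then have "0 \<le> Min (e ` {t + 1..2 * t})"
      using e by auto
    moreover have "(4 * (1 + \<nu>) / ((1 - \<nu>) * \<rho> * G * real t)) powr ?r
        = hidden_const \<nu> * (L powr (2 / (1 - \<nu>)) * \<rho> powr (- ?r) * real t powr (- ?r))"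
      using rate_bound_eq_hidden_const assms \<open>\<nu> < 1\<close> elim(2) by simp
    ultimately show "\<bar>Min (e ` {t + 1..2 * t})\<bar>
        \<le> hidden_const \<nu> * (L powr (2 / (1 - \<nu>)) * \<rho> powr (- ?r) * real t powr (- ?r))"
      using main[OF elim(2)] elim(1) by (simp add: mult.assoc)
  qed
qed

end
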